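(* Let $N \xrightarrow{k} G \xrightarrow{e} H$ be a weakly Schreier extension of monoids, let $s\colon H \to G$ be a set-theoretic splitting of $e$ such that each $s(h)$ is a generator of the fibre $e^{-1}(h)$, and let $(E,\alpha,\chi)$ be a factor system associated to this extension and to the splitting $s$. Let $N \rtimes_{E,\alpha}^{\chi} H$ be the crossed product of $(E,\alpha,\chi)$. Then the map $$f\colon N \rtimes_{E,\alpha}^{\chi} H \to G,\qquad f([n],h) = k(n)s(h),$$ is an isomorphism of monoids. Moreover, with $k'\colon N \to N \rtimes_{E,\alpha}^{\chi} H$, $k'(n) = ([n],1)$, and $e'\colon N \rtimes_{E,\alpha}^{\chi} H \to H$, $e'([n],h) = h$, the diagram $N \xrightarrow{k'} N \rtimes_{E,\alpha}^{\chi} H \xrightarrow{e'} H$ is an extension and $f$ is an isomorphism of extensions, i.e. $f k' = k$ and $e f = e'$.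
   Context: An extension of monoids is a diagram of monoid homomorphisms $N \xrightarrow{k} G \xrightarrow{e} H$ in which $k$ is the kernel of $e$ and $e$ is the cokernel of $k$ (in the category of monoids). The extension is weakly Schreier if in each fibre $e^{-1}(h)$, $h\in H$, there is an element $u_h$, called a (weak) generator, such that for each $g \in e^{-1}(h)$ there exists a (not necessarily unique) $n\in N$ with $g = k(n)u_h$. A set-theoretic splitting of $e$ is a function $s\colon H\to G$ with $e(s(h)) = h$ for all $h \in H$. Factor system. Let $N,H$ be monoids. A factor system is a triple $(E,\alpha,\chi)$ where $E = (\sim^h)_{h\in H}$ is an $H$-indexed family of equivalence relations on the set $N$, and $\alpha\colon H\times N\to N$, $\chi\colon H\times H\to N$ are functions, such that for all $n,n_1,n_2,x\in N$ and $h,h_1,h_2\in H$: (1) $n_1 \sim^1 n_2$ implies $n_1=n_2$; (2) $n_1\sim^h n_2$ implies $xn_1\sim^h xn_2$; (3) $n_1\sim^{h_1} n_2$ implies $n_1\chi(h_1,h_2)\sim^{h_1h_2} n_2\chi(h_1,h_2)$; (4) $n_1\sim^h n_2$ implies $n_1\alpha(h,n)\sim^h n_2\alpha(h,n)$; (5) $n_1\sim^{h_2}n_2$ implies $\alpha(h_1,n_1)\chi(h_1,h_2)\sim^{h_1h_2}\alpha(h_1,n_2)\chi(h_1,h_2)$; (6) $\alpha(h,n_1n_2)\sim^h\alpha(h,n_1)\alpha(h,n_2)$; (7) $\chi(h_1,h_2)\alpha(h_1h_2,n)\sim^{h_1h_2}\alpha(h_1,\alpha(h_2,n))\chi(h_1,h_2)$;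 (8) $\alpha(h,1)\sim^h 1$; (9) $\alpha(1,n)\sim^1 n$; (10) $\chi(1,h)\sim^h 1\sim^h\chi(h,1)$; (11) $\chi(a,b)\chi(ab,c)\sim^{abc}\alpha(a,\chi(b,c))\chi(a,bc)$ for all $a,b,c\in H$. Associated factor system. Given a weakly Schreier extension $N \xrightarrow{k} G \xrightarrow{e} H$ and a set-theoretic splitting $s$ of $e$ selecting generators, a factor system $(E,\alpha,\chi)$ is associated to the extension and $s$ if: $n_1\sim^h n_2$ if and only if $k(n_1)s(h)=k(n_2)s(h)$; $k(\alpha(h,n))s(h)=s(h)k(n)$ for all $h\in H$, $n\in N$; and $k(\chi(h_1,h_2))s(h_1h_2)=s(h_1)s(h_2)$ for all $h_1,h_2\in H$. Crossed product. For a factor system $(E,\alpha,\chi)$, $N\rtimes_{E,\alpha}^{\chi}H$ is the monoid with underlying set the disjoint union $\bigsqcup_{h\in H}N/{\sim^h}$, whose elements are written $([n],h)$ with $[n]$ the $\sim^h$-class of $n$, with multiplication $([n_1],h_1)([n_2],h_2)=([n_1\alpha(h_1,n_2)\chi(h_1,h_2)],h_1h_2)$ and unit $([1],1)$. *)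

theory Defs
  imports "HOL-Algebra.Group"
begin

section \<open>Homomorphisms of monoids\<close>

text \<open>The library's \<open>hom\<close> only asks for compatibility with multiplication; a homomorphism of
  monoids must also preserve the unit.\<close>

definition monoid_hom :: "('a, 'm) monoid_scheme \<Rightarrow> ('b, 'n) monoid_scheme \<Rightarrow> ('a \<Rightarrow> 'b) set" where
  "monoid_hom G H = {f \<in> hom G H. f \<one>\<^bsub>G\<^esub> = \<one>\<^bsub>H\<^esub>}"

definition monoid_iso :: "('a, 'm) monoid_scheme \<Rightarrow> ('b, 'n) monoid_scheme \<Rightarrow> ('a \<Rightarrow> 'b) set" where
  "monoid_iso G H = {f \<in> monoid_hom G H. bij_betw f (carrier G) (carrier H)}"


section \<open>Kernels, cokernels and extensions\<close>

text \<open>The universal properties in the category of monoids. A formula cannot quantify over types, so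
  the type \<open>'u\<close> of the elements of the test monoids is a parameter. Maps are compared
  on carriers only; \<open>extensional\<close> picks one function for each map on a carrier.\<close>

definition is_kernel_in ::
  "'u itself \<Rightarrow> ('n, 'a) monoid_scheme \<Rightarrow> ('g, 'b) monoid_scheme \<Rightarrow> ('h, 'c) monoid_scheme
    \<Rightarrow> ('n \<Rightarrow> 'g) \<Rightarrow> ('g \<Rightarrow> 'h) \<Rightarrow> bool" where
  "is_kernel_in (_ :: 'u itself) N G H k e \<longleftrightarrow>
    k \<in> monoid_hom N G \<and> (\<forall>n\<in>carrier N. e (k n) = \<one>\<^bsub>H\<^esub>) \<and>
    (\<forall>(M :: 'u monoid) t. monoid M \<and> t \<in> monoid_hom M G \<and> (\<forall>x\<in>carrier M. e (t x) = \<one>\<^bsub>H\<^esub>) \<longrightarrow>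
      (\<exists>!t'. t' \<in> monoid_hom M N \<inter> extensional (carrier M) \<and> (\<forall>x\<in>carrier M. k (t' x) = t x)))"

definition is_cokernel_in ::
  "'u itself \<Rightarrow> ('n, 'a) monoid_scheme \<Rightarrow> ('g, 'b) monoid_scheme \<Rightarrow> ('h, 'c) monoid_scheme
    \<Rightarrow> ('n \<Rightarrow> 'g) \<Rightarrow> ('g \<Rightarrow> 'h) \<Rightarrow> bool" where
  "is_cokernel_in (_ :: 'u itself) N G H k e \<longleftrightarrow>
    e \<in> monoid_hom G H \<and> (\<forall>n\<in>carrier N. e (k n) = \<one>\<^bsub>H\<^esub>) \<and>
    (\<forall>(M :: 'u monoid) q. monoid M \<and> q \<in> monoid_hom G M \<and> (\<forall>n\<in>carrier N. q (k n) = \<one>\<^bsub>M\<^esub>) \<longrightarrow>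
      (\<exists>!q'. q' \<in> monoid_hom H M \<inter> extensional (carrier H) \<and> (\<forall>g\<in>carrier G. q' (e g) = q g)))"

text \<open>The type \<open>'n + 'g set + 'h\<close> has room for copies of \<open>N\<close>, of \<open>H\<close>, of all submonoids and of all
  quotients of \<open>G\<close>. Testing on this type already gives the universal
  properties for test monoids of every type: see \<open>monoid_extension_universal\<close> below.\<close>

definition monoid_extension ::
  "('n, 'a) monoid_scheme \<Rightarrow> ('g, 'b) monoid_scheme \<Rightarrow> ('h, 'c) monoid_scheme
    \<Rightarrow> ('n \<Rightarrow> 'g) \<Rightarrow> ('g \<Rightarrow> 'h) \<Rightarrow> bool" where
  "monoid_extension N G H k e \<longleftrightarrow>
    monoid N \<and> monoid G \<and> monoid H \<and> k \<in> monoid_hom N G \<and> e \<in> monoid_hom G H \<and>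
    is_kernel_in TYPE('n + 'g set + 'h) N G H k e \<and>
    is_cokernel_in TYPE('n + 'g set + 'h) N G H k e"

definition weak_generator ::
  "('n, 'a) monoid_scheme \<Rightarrow> ('g, 'b) monoid_scheme \<Rightarrow> ('n \<Rightarrow> 'g) \<Rightarrow> ('g \<Rightarrow> 'h) \<Rightarrow> 'h \<Rightarrow> 'g \<Rightarrow> bool" where
  "weak_generator N G k e h u \<longleftrightarrow>
    u \<in> carrier G \<and> e u = h \<and>
    (\<forall>g\<in>carrier G. e g = h \<longrightarrow> (\<exists>n\<in>carrier N. g = k n \<otimes>\<^bsub>G\<^esub> u))"

definition weakly_Schreier ::
  "('n, 'a) monoid_scheme \<Rightarrow> ('g, 'b) monoid_scheme \<Rightarrow> ('h, 'c) monoid_scheme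
    \<Rightarrow> ('n \<Rightarrow> 'g) \<Rightarrow> ('g \<Rightarrow> 'h) \<Rightarrow> bool" where
  "weakly_Schreier N G H k e \<longleftrightarrow>
    monoid_extension N G H k e \<and> (\<forall>h\<in>carrier H. \<exists>u. weak_generator N G k e h u)"

definition set_splitting ::
  "('g, 'b) monoid_scheme \<Rightarrow> ('h, 'c) monoid_scheme \<Rightarrow> ('g \<Rightarrow> 'h) \<Rightarrow> ('h \<Rightarrow> 'g) \<Rightarrow> bool" where
  "set_splitting G H e s \<longleftrightarrow> s \<in> carrier H \<rightarrow> carrier G \<and> (\<forall>h\<in>carrier H. e (s h) = h)"


section \<open>Factor systems and crossed products\<close>

text \<open>\<open>(n\<^sub>1, n\<^sub>2) \<in> E h\<close> stands for \<open>n\<^sub>1 \<sim>\<^sup>h n\<^sub>2\<close>.\<close>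

locale factor_system = N: monoid N + H: monoid H
  for N :: "('n, 'a) monoid_scheme" (structure) and H :: "('h, 'c) monoid_scheme" (structure) +
  fixes E :: "'h \<Rightarrow> ('n \<times> 'n) set" and \<alpha> :: "'h \<Rightarrow> 'n \<Rightarrow> 'n" and \<chi> :: "'h \<Rightarrow> 'h \<Rightarrow> 'n"
  assumes equiv: "h \<in> carrier H \<Longrightarrow> equiv (carrier N) (E h)"
    and act_closed: "\<lbrakk>h \<in> carrier H; n \<in> carrier N\<rbrakk> \<Longrightarrow> \<alpha> h n \<in> carrier N"
    and cocycle_closed: "\<lbrakk>h\<^sub>1 \<in> carrier H; h\<^sub>2 \<in> carrier H\<rbrakk> \<Longrightarrow> \<chi> h\<^sub>1 h\<^sub>2 \<in> carrier N"
    and rel_one: "(n\<^sub>1, n\<^sub>2) \<in> E \<one>\<^bsub>H\<^esub> \<Longrightarrow> n\<^sub>1 = n\<^sub>2"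
    and rel_left: "\<lbrakk>h \<in> carrier H; x \<in> carrier N; (n\<^sub>1, n\<^sub>2) \<in> E h\<rbrakk>
      \<Longrightarrow> (x \<otimes>\<^bsub>N\<^esub> n\<^sub>1, x \<otimes>\<^bsub>N\<^esub> n\<^sub>2) \<in> E h"
    and rel_cocycle: "\<lbrakk>h\<^sub>1 \<in> carrier H; h\<^sub>2 \<in> carrier H; (n\<^sub>1, n\<^sub>2) \<in> E h\<^sub>1\<rbrakk>
      \<Longrightarrow> (n\<^sub>1 \<otimes>\<^bsub>N\<^esub> \<chi> h\<^sub>1 h\<^sub>2, n\<^sub>2 \<otimes>\<^bsub>N\<^esub> \<chi> h\<^sub>1 h\<^sub>2) \<in> E (h\<^sub>1 \<otimes>\<^bsub>H\<^esub> h\<^sub>2)"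
    and rel_act: "\<lbrakk>h \<in> carrier H; n \<in> carrier N; (n\<^sub>1, n\<^sub>2) \<in> E h\<rbrakk>
      \<Longrightarrow> (n\<^sub>1 \<otimes>\<^bsub>N\<^esub> \<alpha> h n, n\<^sub>2 \<otimes>\<^bsub>N\<^esub> \<alpha> h n) \<in> E h"
    and act_rel: "\<lbrakk>h\<^sub>1 \<in> carrier H; h\<^sub>2 \<in> carrier H; (n\<^sub>1, n\<^sub>2) \<in> E h\<^sub>2\<rbrakk>
      \<Longrightarrow> (\<alpha> h\<^sub>1 n\<^sub>1 \<otimes>\<^bsub>N\<^esub> \<chi> h\<^sub>1 h\<^sub>2, \<alpha> h\<^sub>1 n\<^sub>2 \<otimes>\<^bsub>N\<^esub> \<chi> h\<^sub>1 h\<^sub>2) \<in> E (h\<^sub>1 \<otimes>\<^bsub>H\<^esub> h\<^sub>2)"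
    and act_mult: "\<lbrakk>h \<in> carrier H; n\<^sub>1 \<in> carrier N; n\<^sub>2 \<in> carrier N\<rbrakk>
      \<Longrightarrow> (\<alpha> h (n\<^sub>1 \<otimes>\<^bsub>N\<^esub> n\<^sub>2), \<alpha> h n\<^sub>1 \<otimes>\<^bsub>N\<^esub> \<alpha> h n\<^sub>2) \<in> E h"
    and cocycle_act: "\<lbrakk>h\<^sub>1 \<in> carrier H; h\<^sub>2 \<in> carrier H; n \<in> carrier N\<rbrakk>
      \<Longrightarrow> (\<chi> h\<^sub>1 h\<^sub>2 \<otimes>\<^bsub>N\<^esub> \<alpha> (h\<^sub>1 \<otimes>\<^bsub>H\<^esub> h\<^sub>2) n, \<alpha> h\<^sub>1 (\<alpha> h\<^sub>2 n) \<otimes>\<^bsub>N\<^esub> \<chi> h\<^sub>1 h\<^sub>2) \<in> E (h\<^sub>1 \<otimes>\<^bsub>H\<^esub> h\<^sub>2)"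
    and act_unit: "h \<in> carrier H \<Longrightarrow> (\<alpha> h \<one>\<^bsub>N\<^esub>, \<one>\<^bsub>N\<^esub>) \<in> E h"
    and unit_act: "n \<in> carrier N \<Longrightarrow> (\<alpha> \<one>\<^bsub>H\<^esub> n, n) \<in> E \<one>\<^bsub>H\<^esub>"
    and cocycle_unit_left: "h \<in> carrier H \<Longrightarrow> (\<chi> \<one>\<^bsub>H\<^esub> h, \<one>\<^bsub>N\<^esub>) \<in> E h"
    and cocycle_unit_right: "h \<in> carrier H \<Longrightarrow> (\<one>\<^bsub>N\<^esub>, \<chi> h \<one>\<^bsub>H\<^esub>) \<in> E h"
    and cocycle_assoc: "\<lbrakk>a \<in> carrier H; b \<in> carrier H; c \<in> carrier H\<rbrakk>
      \<Longrightarrow> (\<chi> a b \<otimes>\<^bsub>N\<^esub> \<chi> (a \<otimes>\<^bsub>H\<^esub> b) c, \<alpha> a (\<chi> b c) \<otimes>\<^bsub>N\<^esub> \<chi> a (b \<otimes>\<^bsub>H\<^esub> c))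
            \<in> E (a \<otimes>\<^bsub>H\<^esub> b \<otimes>\<^bsub>H\<^esub> c)"

definition associated_factor_system ::
  "('n, 'a) monoid_scheme \<Rightarrow> ('g, 'b) monoid_scheme \<Rightarrow> ('h, 'c) monoid_scheme
    \<Rightarrow> ('n \<Rightarrow> 'g) \<Rightarrow> ('h \<Rightarrow> 'g)
    \<Rightarrow> ('h \<Rightarrow> ('n \<times> 'n) set) \<Rightarrow> ('h \<Rightarrow> 'n \<Rightarrow> 'n) \<Rightarrow> ('h \<Rightarrow> 'h \<Rightarrow> 'n) \<Rightarrow> bool" where
  "associated_factor_system N G H k s E \<alpha> \<chi> \<longleftrightarrow>
    factor_system N H E \<alpha> \<chi> \<and>
    (\<forall>h\<in>carrier H. \<forall>n\<^sub>1\<in>carrier N. \<forall>n\<^sub>2\<in>carrier N.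
       (n\<^sub>1, n\<^sub>2) \<in> E h \<longleftrightarrow> k n\<^sub>1 \<otimes>\<^bsub>G\<^esub> s h = k n\<^sub>2 \<otimes>\<^bsub>G\<^esub> s h) \<and>
    (\<forall>h\<in>carrier H. \<forall>n\<in>carrier N. k (\<alpha> h n) \<otimes>\<^bsub>G\<^esub> s h = s h \<otimes>\<^bsub>G\<^esub> k n) \<and>
    (\<forall>h\<^sub>1\<in>carrier H. \<forall>h\<^sub>2\<in>carrier H. k (\<chi> h\<^sub>1 h\<^sub>2) \<otimes>\<^bsub>G\<^esub> s (h\<^sub>1 \<otimes>\<^bsub>H\<^esub> h\<^sub>2) = s h\<^sub>1 \<otimes>\<^bsub>G\<^esub> s h\<^sub>2)"

text \<open>The class of a product of representatives does not depend on the representatives, so the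
  union below is a union of equal classes: see \<open>factor_system.crossed_product_mult\<close>.\<close>

definition crossed_product ::
  "('n, 'a) monoid_scheme \<Rightarrow> ('h, 'c) monoid_scheme
    \<Rightarrow> ('h \<Rightarrow> ('n \<times> 'n) set) \<Rightarrow> ('h \<Rightarrow> 'n \<Rightarrow> 'n) \<Rightarrow> ('h \<Rightarrow> 'h \<Rightarrow> 'n) \<Rightarrow> ('n set \<times> 'h) monoid" where
  "crossed_product N H E \<alpha> \<chi> =
    \<lparr>carrier = {(C, h). h \<in> carrier H \<and> C \<in> carrier N // E h},
     mult = (\<lambda>(C\<^sub>1, h\<^sub>1) (C\<^sub>2, h\<^sub>2).
       (\<Union>n\<^sub>1\<in>C\<^sub>1. \<Union>n\<^sub>2\<in>C\<^sub>2. E (h\<^sub>1 \<otimes>\<^bsub>H\<^esub> h\<^sub>2) `` {n\<^sub>1 \<otimes>\<^bsub>N\<^esub> \<alpha> h\<^sub>1 n\<^sub>2 \<otimes>\<^bsub>N\<^esub> \<chi> h\<^sub>1 h\<^sub>2},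
        h\<^sub>1 \<otimes>\<^bsub>H\<^esub> h\<^sub>2)),
     one = (E \<one>\<^bsub>H\<^esub> `` {\<one>\<^bsub>N\<^esub>}, \<one>\<^bsub>H\<^esub>)\<rparr>"

definition crossed_product_incl ::
  "('h, 'c) monoid_scheme \<Rightarrow> ('h \<Rightarrow> ('n \<times> 'n) set) \<Rightarrow> 'n \<Rightarrow> 'n set \<times> 'h" where
  "crossed_product_incl H E n = (E \<one>\<^bsub>H\<^esub> `` {n}, \<one>\<^bsub>H\<^esub>)"

definition crossed_product_proj :: "'n set \<times> 'h \<Rightarrow> 'h" where
  "crossed_product_proj = (\<lambda>(C, h). h)"

text \<open>The value at \<open>(C, h)\<close> is the single element of \<open>{k n s(h) | n \<in> C}\<close>.\<close>

definition crossed_product_map ::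
  "('g, 'b) monoid_scheme \<Rightarrow> ('n \<Rightarrow> 'g) \<Rightarrow> ('h \<Rightarrow> 'g) \<Rightarrow> 'n set \<times> 'h \<Rightarrow> 'g" where
  "crossed_product_map G k s = (\<lambda>(C, h). the_elem ((\<lambda>n. k n \<otimes>\<^bsub>G\<^esub> s h) ` C))"

lemma (in factor_system) crossed_product_mult:
  assumes h: "h\<^sub>1 \<in> carrier H" "h\<^sub>2 \<in> carrier H" and n: "n\<^sub>1 \<in> carrier N" "n\<^sub>2 \<in> carrier N"
  shows "(E h\<^sub>1 `` {n\<^sub>1}, h\<^sub>1) \<otimes>\<^bsub>crossed_product N H E \<alpha> \<chi>\<^esub> (E h\<^sub>2 `` {n\<^sub>2}, h\<^sub>2) =
    (E (h\<^sub>1 \<otimes>\<^bsub>H\<^esub> h\<^sub>2) `` {n\<^sub>1 \<otimes>\<^bsub>N\<^esub> \<alpha> h\<^sub>1 n\<^sub>2 \<otimes>\<^bsub>N\<^esub> \<chi> h\<^sub>1 h\<^sub>2}, h\<^sub>1 \<otimes>\<^bsub>H\<^esub> h\<^sub>2)"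
proof -
  let ?p = "\<lambda>a b. a \<otimes>\<^bsub>N\<^esub> \<alpha> h\<^sub>1 b \<otimes>\<^bsub>N\<^esub> \<chi> h\<^sub>1 h\<^sub>2"
  have hh: "h\<^sub>1 \<otimes>\<^bsub>H\<^esub> h\<^sub>2 \<in> carrier H" using h by simp
  have carr: "a \<in> carrier N \<and> b \<in> carrier N" if "h \<in> carrier H" "(a, b) \<in> E h" for a b h
    using equiv[OF that(1)] that(2) unfolding equiv_def by blast
  have cong: "(?p n\<^sub>1 n\<^sub>2, ?p a b) \<in> E (h\<^sub>1 \<otimes>\<^bsub>H\<^esub> h\<^sub>2)"
    if ab: "(n\<^sub>1, a) \<in> E h\<^sub>1" "(n\<^sub>2, b) \<in> E h\<^sub>2" for a b
  proof -
    have c: "a \<in> carrier N" "b \<in> carrier N" using carr ab h by blast+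
    have "(?p n\<^sub>1 n\<^sub>2, ?p a n\<^sub>2) \<in> E (h\<^sub>1 \<otimes>\<^bsub>H\<^esub> h\<^sub>2)"
      using rel_cocycle[OF h rel_act[OF h(1) n(2) ab(1)]] .
    moreover have "(?p a n\<^sub>2, ?p a b) \<in> E (h\<^sub>1 \<otimes>\<^bsub>H\<^esub> h\<^sub>2)"
      using rel_left[OF hh c(1) act_rel[OF h ab(2)]] c n h
      by (simp add: N.m_assoc act_closed cocycle_closed)
    ultimately show ?thesis
      using equiv[OF hh] unfolding equiv_def by (blast dest: transD)
  qed
  have self: "(n\<^sub>1, n\<^sub>1) \<in> E h\<^sub>1" "(n\<^sub>2, n\<^sub>2) \<in> E h\<^sub>2"
    using equiv h n unfolding equiv_def refl_on_def by blast+
  have "E (h\<^sub>1 \<otimes>\<^bsub>H\<^esub> h\<^sub>2) `` {?p a b} = E (h\<^sub>1 \<otimes>\<^bsub>H\<^esub> h\<^sub>2) `` {?p n\<^sub>1 n\<^sub>2}"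
    if "a \<in> E h\<^sub>1 `` {n\<^sub>1}" "b \<in> E h\<^sub>2 `` {n\<^sub>2}" for a b
    using equiv_class_eq[OF equiv[OF hh] cong] that by simp
  then have "(\<Union>a\<in>E h\<^sub>1 `` {n\<^sub>1}. \<Union>b\<in>E h\<^sub>2 `` {n\<^sub>2}. E (h\<^sub>1 \<otimes>\<^bsub>H\<^esub> h\<^sub>2) `` {?p a b})
      = E (h\<^sub>1 \<otimes>\<^bsub>H\<^esub> h\<^sub>2) `` {?p n\<^sub>1 n\<^sub>2}"
    using self by blast
  then show ?thesis by (simp add: crossed_product_def)
qed


section \<open>The universal properties hold for test monoids of every type\<close>

lemma monoid_homD:
  assumes "f \<in> monoid_hom G H"
  shows "x \<in> carrier G \<Longrightarrow> f x \<in> carrier H"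
    and "\<lbrakk>x \<in> carrier G; y \<in> carrier G\<rbrakk> \<Longrightarrow> f (x \<otimes>\<^bsub>G\<^esub> y) = f x \<otimes>\<^bsub>H\<^esub> f y"
    and "f \<one>\<^bsub>G\<^esub> = \<one>\<^bsub>H\<^esub>"
  using assms unfolding monoid_hom_def hom_def by auto

lemma monoid_homI:
  assumes "\<And>x. x \<in> carrier G \<Longrightarrow> f x \<in> carrier H"
    and "\<And>x y. \<lbrakk>x \<in> carrier G; y \<in> carrier G\<rbrakk> \<Longrightarrow> f (x \<otimes>\<^bsub>G\<^esub> y) = f x \<otimes>\<^bsub>H\<^esub> f y"
    and "f \<one>\<^bsub>G\<^esub> = \<one>\<^bsub>H\<^esub>"
  shows "f \<in> monoid_hom G H"
  using assms unfolding monoid_hom_def hom_def by auto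

lemma monoid_hom_comp:
  assumes "f \<in> monoid_hom G H" "g \<in> monoid_hom H K"
  shows "(\<lambda>x. g (f x)) \<in> monoid_hom G K"
  using monoid_homD[OF assms(1)] monoid_homD[OF assms(2)] by (intro monoid_homI) auto

lemma monoid_hom_restrict:
  assumes "monoid G" "f \<in> monoid_hom G H"
  shows "restrict f (carrier G) \<in> monoid_hom G H"
  using monoid_homD[OF assms(2)] monoid.m_closed[OF assms(1)] monoid.one_closed[OF assms(1)]
  by (intro monoid_homI) auto

lemma ex1_unique: "\<exists>!x. P x \<Longrightarrow> P a \<Longrightarrow> P b \<Longrightarrow> a = b"
  by blast

definition monoid_copy :: "('a \<Rightarrow> 'u) \<Rightarrow> ('a, 'm) monoid_scheme \<Rightarrow> 'u monoid" where
  "monoid_copy i M = \<lparr>carrier = i ` carrier M,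
    mult = (\<lambda>x y. i (inv_into UNIV i x \<otimes>\<^bsub>M\<^esub> inv_into UNIV i y)), one = i \<one>\<^bsub>M\<^esub>\<rparr>"

lemma monoid_copy:
  assumes "inj i" "monoid M"
  shows "monoid (monoid_copy i M)"
    and "i \<in> monoid_hom M (monoid_copy i M)"
    and "inv_into UNIV i \<in> monoid_hom (monoid_copy i M) M"
proof -
  interpret monoid M by fact
  have [simp]: "inv_into UNIV i (i x) = x" for x using assms(1) by simp
  show "monoid (monoid_copy i M)"
    by (rule monoidI) (auto simp: monoid_copy_def m_assoc)
  show "i \<in> monoid_hom M (monoid_copy i M)"
    by (rule monoid_homI) (auto simp: monoid_copy_def)
  show "inv_into UNIV i \<in> monoid_hom (monoid_copy i M) M"
    by (rule monoid_homI) (auto simp: monoid_copy_def)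
qed

lemma kernel_test:
  fixes i :: "'t \<Rightarrow> 'u" and M :: "('t, 'm) monoid_scheme"
  assumes ker: "is_kernel_in TYPE('u) N G H k e" and i: "inj i" and M: "monoid M"
    and t: "t \<in> monoid_hom M G" "\<And>x. x \<in> carrier M \<Longrightarrow> e (t x) = \<one>\<^bsub>H\<^esub>"
  shows "\<exists>t'\<in>monoid_hom M N. \<forall>x\<in>carrier M. k (t' x) = t x"
    and "\<lbrakk>a \<in> monoid_hom M N; b \<in> monoid_hom M N; \<And>x. x \<in> carrier M \<Longrightarrow> k (a x) = t x;
          \<And>x. x \<in> carrier M \<Longrightarrow> k (b x) = t x; x \<in> carrier M\<rbrakk> \<Longrightarrow> a x = b x"
proof -
  let ?M = "monoid_copy i M" and ?j = "inv_into UNIV i"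
  note c = monoid_copy[OF i M]
  have ji: "?j (i x) = x" for x using i by simp
  have cM: "carrier ?M = i ` carrier M" by (simp add: monoid_copy_def)
  have "(\<lambda>x. t (?j x)) \<in> monoid_hom ?M G" by (rule monoid_hom_comp[OF c(3) t(1)])
  moreover have "\<forall>x\<in>carrier ?M. e (t (?j x)) = \<one>\<^bsub>H\<^esub>" using t(2) by (auto simp: cM ji)
  ultimately have ex1: "\<exists>!t'. t' \<in> monoid_hom ?M N \<inter> extensional (carrier ?M) \<and>
      (\<forall>x\<in>carrier ?M. k (t' x) = t (?j x))"
    using ker c(1) unfolding is_kernel_in_def by blast
  then obtain t' where t': "t' \<in> monoid_hom ?M N" "\<forall>x\<in>carrier ?M. k (t' x) = t (?j x)" by blast
  show "\<exists>t'\<in>monoid_hom M N. \<forall>x\<in>carrier M. k (t' x) = t x"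
    using monoid_hom_comp[OF c(2) t'(1)] t'(2) by (intro bexI[of _ "\<lambda>x. t' (i x)"]) (auto simp: cM ji)
  show "a x = b x" if a: "a \<in> monoid_hom M N" and b: "b \<in> monoid_hom M N"
    and ka: "\<And>x. x \<in> carrier M \<Longrightarrow> k (a x) = t x"
    and kb: "\<And>x. x \<in> carrier M \<Longrightarrow> k (b x) = t x" and x: "x \<in> carrier M"
  proof -
    have "restrict (\<lambda>y. a (?j y)) (carrier ?M) = restrict (\<lambda>y. b (?j y)) (carrier ?M)"
      using monoid_hom_restrict[OF c(1) monoid_hom_comp[OF c(3) a]]
        monoid_hom_restrict[OF c(1) monoid_hom_comp[OF c(3) b]] ka kb
      by (intro ex1_unique[OF ex1]) (auto simp: cM ji)
    then have "restrict (\<lambda>y. a (?j y)) (carrier ?M) (i x) = restrict (\<lambda>y. b (?j y)) (carrier ?M) (i x)"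
      by simp
    then show ?thesis using x by (simp add: cM ji)
  qed
qed

lemma cokernel_test:
  fixes i :: "'t \<Rightarrow> 'u" and M :: "('t, 'm) monoid_scheme"
  assumes coker: "is_cokernel_in TYPE('u) N G H k e" and i: "inj i" and H: "monoid H" and M: "monoid M"
    and q: "q \<in> monoid_hom G M" "\<And>n. n \<in> carrier N \<Longrightarrow> q (k n) = \<one>\<^bsub>M\<^esub>"
  shows "\<exists>q'\<in>monoid_hom H M. \<forall>g\<in>carrier G. q' (e g) = q g"
    and "\<lbrakk>a \<in> monoid_hom H M; b \<in> monoid_hom H M; \<And>g. g \<in> carrier G \<Longrightarrow> a (e g) = q g;
          \<And>g. g \<in> carrier G \<Longrightarrow> b (e g) = q g; h \<in> carrier H\<rbrakk> \<Longrightarrow> a h = b h"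
proof -
  let ?M = "monoid_copy i M" and ?j = "inv_into UNIV i"
  note c = monoid_copy[OF i M]
  have ji: "?j (i x) = x" for x using i by simp
  have e: "e g \<in> carrier H" if "g \<in> carrier G" for g
    using coker that unfolding is_cokernel_in_def by (blast dest: monoid_homD)
  have "(\<lambda>x. i (q x)) \<in> monoid_hom G ?M" by (rule monoid_hom_comp[OF q(1) c(2)])
  moreover have "\<forall>n\<in>carrier N. i (q (k n)) = \<one>\<^bsub>?M\<^esub>" using q(2) by (simp add: monoid_copy_def)
  ultimately have ex1: "\<exists>!q'. q' \<in> monoid_hom H ?M \<inter> extensional (carrier H) \<and>
      (\<forall>g\<in>carrier G. q' (e g) = i (q g))"
    using coker c(1) unfolding is_cokernel_in_def by blast
  then obtain q' where q': "q' \<in> monoid_hom H ?M" "\<forall>g\<in>carrier G. q' (e g) = i (q g)" by blast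
  show "\<exists>q'\<in>monoid_hom H M. \<forall>g\<in>carrier G. q' (e g) = q g"
    using monoid_hom_comp[OF q'(1) c(3)] q'(2) by (intro bexI[of _ "\<lambda>x. ?j (q' x)"]) (auto simp: ji)
  show "a h = b h" if a: "a \<in> monoid_hom H M" and b: "b \<in> monoid_hom H M"
    and ka: "\<And>g. g \<in> carrier G \<Longrightarrow> a (e g) = q g"
    and kb: "\<And>g. g \<in> carrier G \<Longrightarrow> b (e g) = q g" and h: "h \<in> carrier H"
  proof -
    have "restrict (\<lambda>y. i (a y)) (carrier H) = restrict (\<lambda>y. i (b y)) (carrier H)"
      using monoid_hom_restrict[OF H monoid_hom_comp[OF a c(2)]]
        monoid_hom_restrict[OF H monoid_hom_comp[OF b c(2)]] ka kb
      by (intro ex1_unique[OF ex1]) (auto simp: e)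
    then have "restrict (\<lambda>y. i (a y)) (carrier H) h = restrict (\<lambda>y. i (b y)) (carrier H) h"
      by simp
    then show ?thesis using h i by (simp add: inj_eq)
  qed
qed

lemma monoid_extension_kernel:
  fixes N :: "('n, 'a) monoid_scheme" and G :: "('g, 'b) monoid_scheme" and H :: "('h, 'c) monoid_scheme"
  assumes ext: "monoid_extension N G H k e"
  shows "inj_on k (carrier N)" and "k ` carrier N = {g \<in> carrier G. e g = \<one>\<^bsub>H\<^esub>}"
proof -
  have mon: "monoid N" "monoid G" "monoid H" and k: "k \<in> monoid_hom N G" and e: "e \<in> monoid_hom G H"
    and ker: "is_kernel_in TYPE('n + 'g set + 'h) N G H k e"
    using ext unfolding monoid_extension_def by auto
  interpret N: monoid N by (rule mon)
  interpret G: monoid G by (rule mon)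
  interpret H: monoid H by (rule mon)
  have ek: "\<And>n. n \<in> carrier N \<Longrightarrow> e (k n) = \<one>\<^bsub>H\<^esub>" using ker unfolding is_kernel_in_def by auto
  define K where "K = \<lparr>carrier = {g \<in> carrier G. e g = \<one>\<^bsub>H\<^esub>}, mult = mult G, one = \<one>\<^bsub>G\<^esub>\<rparr>"
  have K: "monoid K"
    by (rule monoidI) (auto simp: K_def G.m_assoc monoid_homD[OF e])
  have incl: "(\<lambda>x. x) \<in> monoid_hom K G" by (rule monoid_homI) (auto simp: K_def)
  have "inj (\<lambda>x. Inr (Inl {x}) :: 'n + 'g set + 'h)" by (auto simp: inj_on_def)
  from kernel_test(1)[OF ker this K incl] obtain r
    where r: "r \<in> monoid_hom K N" "\<forall>x\<in>carrier K. k (r x) = x" by (auto simp: K_def)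
  show img: "k ` carrier N = {g \<in> carrier G. e g = \<one>\<^bsub>H\<^esub>}"
  proof
    show "k ` carrier N \<subseteq> {g \<in> carrier G. e g = \<one>\<^bsub>H\<^esub>}" using ek monoid_homD(1)[OF k] by auto
    show "{g \<in> carrier G. e g = \<one>\<^bsub>H\<^esub>} \<subseteq> k ` carrier N"
    proof
      fix g assume "g \<in> {g \<in> carrier G. e g = \<one>\<^bsub>H\<^esub>}"
      then have "g \<in> carrier K" by (simp add: K_def)
      then show "g \<in> k ` carrier N" using r(2) monoid_homD(1)[OF r(1)] by (metis imageI)
    qed
  qed
  have kK: "k \<in> monoid_hom N K"
    using monoid_homD[OF k] ek by (intro monoid_homI) (auto simp: K_def)
  have "r (k n) = n" if "n \<in> carrier N" for n
  proof (rule kernel_test(2)[OF ker _ mon(1) k ek, where a = "\<lambda>n. r (k n)" and b = "\<lambda>n. n"])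
    show "inj (Inl :: 'n \<Rightarrow> 'n + 'g set + 'h)" by simp
    show "(\<lambda>n. r (k n)) \<in> monoid_hom N N" by (rule monoid_hom_comp[OF kK r(1)])
    show "(\<lambda>n. n) \<in> monoid_hom N N" by (rule monoid_homI) auto
    show "k (r (k x)) = k x" if "x \<in> carrier N" for x using r(2) monoid_homD(1)[OF kK that] by blast
  qed (use that in auto)
  then show "inj_on k (carrier N)" by (rule inj_on_inverseI)
qed

definition generated_congruence ::
  "('n, 'a) monoid_scheme \<Rightarrow> ('g, 'b) monoid_scheme \<Rightarrow> ('n \<Rightarrow> 'g) \<Rightarrow> ('g \<times> 'g) set" where
  "generated_congruence N G k = {(x, y) \<in> carrier G \<times> carrier G. \<forall>R. equiv (carrier G) R \<and>
     (\<forall>a b c d. (a, b) \<in> R \<longrightarrow> (c, d) \<in> R \<longrightarrow> (a \<otimes>\<^bsub>G\<^esub> c, b \<otimes>\<^bsub>G\<^esub> d) \<in> R) \<and>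
     (\<forall>n\<in>carrier N. (k n, \<one>\<^bsub>G\<^esub>) \<in> R) \<longrightarrow> (x, y) \<in> R}"

lemma generated_congruence:
  fixes N :: "('n, 'a) monoid_scheme" and G :: "('g, 'b) monoid_scheme"
  assumes "monoid G" "k \<in> monoid_hom N G"
  defines "R \<equiv> generated_congruence N G k"
  shows "equiv (carrier G) R"
    and "\<And>a b c d. \<lbrakk>(a, b) \<in> R; (c, d) \<in> R\<rbrakk> \<Longrightarrow> (a \<otimes>\<^bsub>G\<^esub> c, b \<otimes>\<^bsub>G\<^esub> d) \<in> R"
    and "\<And>n. n \<in> carrier N \<Longrightarrow> (k n, \<one>\<^bsub>G\<^esub>) \<in> R"
proof -
  interpret G: monoid G by fact
  show "equiv (carrier G) R"
  proof (rule equivI)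
    show "R \<subseteq> carrier G \<times> carrier G" by (auto simp: R_def generated_congruence_def)
    show "refl_on (carrier G) R"
      by (auto simp: R_def generated_congruence_def refl_on_def equiv_def)
    show "sym R"
    proof (rule symI)
      fix x y assume "(x, y) \<in> R"
      then show "(y, x) \<in> R"
        by (auto simp: R_def generated_congruence_def equiv_def dest: symD)
    qed
    show "trans R"
    proof (rule transI)
      fix x y z assume xyz: "(x, y) \<in> R" "(y, z) \<in> R"
      have "(x, z) \<in> S" if "equiv (carrier G) S" "(x, y) \<in> S" "(y, z) \<in> S" for S
        using that unfolding equiv_def by (blast dest: transD)
      then show "(x, z) \<in> R"
        using xyz unfolding R_def generated_congruence_def by simp
    qed
  qed
  show "(a \<otimes>\<^bsub>G\<^esub> c, b \<otimes>\<^bsub>G\<^esub> d) \<in> R" if "(a, b) \<in> R" "(c, d) \<in> R" for a b c d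
    using that unfolding R_def generated_congruence_def by simp
  show "(k n, \<one>\<^bsub>G\<^esub>) \<in> R" if "n \<in> carrier N" for n
    using that monoid_homD(1)[OF assms(2) that] unfolding R_def generated_congruence_def by simp
qed

lemma generated_congruence_hom:
  assumes "monoid G" "monoid M" "q \<in> monoid_hom G M" "\<And>n. n \<in> carrier N \<Longrightarrow> q (k n) = \<one>\<^bsub>M\<^esub>"
    and "k \<in> monoid_hom N G" and xy: "(x, y) \<in> generated_congruence N G k"
  shows "q x = q y"
proof -
  interpret G: monoid G by fact
  define R where "R = {(x, y) \<in> carrier G \<times> carrier G. q x = q y}"
  have "equiv (carrier G) R"
    by (auto intro!: equivI refl_onI symI transI simp: R_def)
  moreover have "\<forall>a b c d. (a, b) \<in> R \<longrightarrow> (c, d) \<in> R \<longrightarrow> (a \<otimes>\<^bsub>G\<^esub> c, b \<otimes>\<^bsub>G\<^esub> d) \<in> R"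
    by (auto simp: R_def monoid_homD[OF assms(3)])
  moreover have "\<forall>n\<in>carrier N. (k n, \<one>\<^bsub>G\<^esub>) \<in> R"
    using assms(4) by (auto simp: R_def monoid_homD[OF assms(3)] monoid_homD[OF assms(5)])
  ultimately have "(x, y) \<in> R" using xy unfolding generated_congruence_def by blast
  then show ?thesis by (simp add: R_def)
qed

lemma monoid_extension_cokernel:
  fixes N :: "('n, 'a) monoid_scheme" and G :: "('g, 'b) monoid_scheme" and H :: "('h, 'c) monoid_scheme"
  assumes ext: "monoid_extension N G H k e"
  shows "e ` carrier G = carrier H"
    and "\<And>x y. \<lbrakk>x \<in> carrier G; y \<in> carrier G; e x = e y\<rbrakk> \<Longrightarrow> (x, y) \<in> generated_congruence N G k"
proof -
  have mon: "monoid N" "monoid G" "monoid H" and k: "k \<in> monoid_hom N G" and e: "e \<in> monoid_hom G H"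
    and coker: "is_cokernel_in TYPE('n + 'g set + 'h) N G H k e"
    using ext unfolding monoid_extension_def by auto
  interpret G: monoid G by (rule mon)
  interpret H: monoid H by (rule mon)
  have ek: "\<And>n. n \<in> carrier N \<Longrightarrow> e (k n) = \<one>\<^bsub>H\<^esub>" using coker unfolding is_cokernel_in_def by auto
  define R where "R = generated_congruence N G k"
  note R = generated_congruence[OF mon(2) k, folded R_def]
  define rep where "rep C = (SOME x. x \<in> C)" for C :: "'g set"
  define Q where "Q = \<lparr>carrier = carrier G // R,
    mult = (\<lambda>C D. R `` {rep C \<otimes>\<^bsub>G\<^esub> rep D}), one = R `` {\<one>\<^bsub>G\<^esub>}\<rparr>"
  have cls: "R `` {x} = R `` {y} \<longleftrightarrow> (x, y) \<in> R" if "x \<in> carrier G" "y \<in> carrier G" for x y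
    using eq_equiv_class_iff[OF R(1) that] .
  have rep: "(x, rep (R `` {x})) \<in> R" "rep (R `` {x}) \<in> carrier G" if "x \<in> carrier G" for x
  proof -
    have "x \<in> R `` {x}" using equiv_class_self[OF R(1) that] .
    then have "rep (R `` {x}) \<in> R `` {x}" unfolding rep_def by (rule someI)
    then show "(x, rep (R `` {x})) \<in> R" "rep (R `` {x}) \<in> carrier G"
      using R(1) unfolding equiv_def by auto
  qed
  have mult: "R `` {x} \<otimes>\<^bsub>Q\<^esub> R `` {y} = R `` {x \<otimes>\<^bsub>G\<^esub> y}" if "x \<in> carrier G" "y \<in> carrier G" for x y
  proof -
    have "(x \<otimes>\<^bsub>G\<^esub> y, rep (R `` {x}) \<otimes>\<^bsub>G\<^esub> rep (R `` {y})) \<in> R" using R(2) rep that by blast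
    then show ?thesis using equiv_class_eq[OF R(1)] by (simp add: Q_def)
  qed
  have car: "carrier Q = (\<lambda>x. R `` {x}) ` carrier G" by (auto simp: Q_def quotient_def)
  have one: "\<one>\<^bsub>Q\<^esub> = R `` {\<one>\<^bsub>G\<^esub>}" by (simp add: Q_def)
  have Q: "monoid Q"
    by (rule monoidI) (auto simp: car one mult G.m_assoc)
  have p: "(\<lambda>x. R `` {x}) \<in> monoid_hom G Q"
    by (rule monoid_homI) (auto simp: car one mult)
  have pk: "R `` {k n} = \<one>\<^bsub>Q\<^esub>" if "n \<in> carrier N" for n
    using R(3)[OF that] monoid_homD(1)[OF k that] by (simp add: one cls)
  have "inj (\<lambda>C. Inr (Inl C) :: 'n + 'g set + 'h)" by (auto simp: inj_on_def)
  from cokernel_test(1)[OF coker this mon(3) Q p pk] obtain v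
    where v: "v \<in> monoid_hom H Q" "\<forall>g\<in>carrier G. v (e g) = R `` {g}" by auto
  show "(x, y) \<in> generated_congruence N G k" if "x \<in> carrier G" "y \<in> carrier G" "e x = e y" for x y
    using v(2) that cls unfolding R_def[symmetric] by metis
  define u where "u C = e (rep C)" for C
  have u: "u (R `` {x}) = e x" if "x \<in> carrier G" for x
    using generated_congruence_hom[OF mon(2,3) e ek k] rep(1)[OF that] unfolding u_def R_def by simp
  have uhom: "u \<in> monoid_hom Q H"
    by (rule monoid_homI) (auto simp: car mult one u monoid_homD[OF e])
  have "u (v h) = h" if "h \<in> carrier H" for h
  proof (rule cokernel_test(2)[OF coker _ mon(3) mon(3) e ek, where a = "\<lambda>h. u (v h)" and b = "\<lambda>h. h"])
    show "inj (\<lambda>h. Inr (Inr h) :: 'n + 'g set + 'h)" by (auto simp: inj_on_def)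
    show "(\<lambda>h. u (v h)) \<in> monoid_hom H H" by (rule monoid_hom_comp[OF v(1) uhom])
    show "(\<lambda>h. h) \<in> monoid_hom H H" by (rule monoid_homI) auto
    show "u (v (e g)) = e g" if "g \<in> carrier G" for g using v(2) u that by simp
  qed (use that in auto)
  moreover have "u C \<in> e ` carrier G" if "C \<in> carrier Q" for C
    using that u by (auto simp: car)
  ultimately show "e ` carrier G = carrier H"
    using monoid_homD(1)[OF e] monoid_homD(1)[OF v(1)] by (metis image_subsetI subsetI subset_antisym)
qed

lemma is_kernel_inI:
  assumes "monoid N" "k \<in> monoid_hom N G" "inj_on k (carrier N)"
    and img: "k ` carrier N = {g \<in> carrier G. e g = \<one>\<^bsub>H\<^esub>}"
  shows "is_kernel_in TYPE('u) N G H k e"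
  unfolding is_kernel_in_def
proof (intro conjI allI impI ballI)
  interpret N: monoid N by fact
  show "k \<in> monoid_hom N G" by fact
  show "e (k n) = \<one>\<^bsub>H\<^esub>" if "n \<in> carrier N" for n using img that by blast
  fix M :: "'u monoid" and t
  assume *: "monoid M \<and> t \<in> monoid_hom M G \<and> (\<forall>x\<in>carrier M. e (t x) = \<one>\<^bsub>H\<^esub>)"
  then interpret M: monoid M by blast
  have t: "t \<in> monoid_hom M G" using * by blast
  define j where "j = inv_into (carrier N) k"
  have tk: "t x \<in> k ` carrier N" if "x \<in> carrier M" for x
    using * img monoid_homD(1)[OF t that] that by blast
  have j: "j (t x) \<in> carrier N" "k (j (t x)) = t x" if "x \<in> carrier M" for x
    using inv_into_into[OF tk[OF that]] f_inv_into_f[OF tk[OF that]] by (auto simp: j_def)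
  have jk: "j (k n) = n" if "n \<in> carrier N" for n
    using assms(3) that by (simp add: j_def)
  have "(\<lambda>x. j (t x)) \<in> monoid_hom M N"
  proof (rule monoid_homI)
    fix x y assume xy: "x \<in> carrier M" "y \<in> carrier M"
    have "k (j (t (x \<otimes>\<^bsub>M\<^esub> y))) = k (j (t x) \<otimes>\<^bsub>N\<^esub> j (t y))"
      using j(2)[OF M.m_closed[OF xy]] xy j by (simp add: monoid_homD[OF t] monoid_homD[OF assms(2)])
    then show "j (t (x \<otimes>\<^bsub>M\<^esub> y)) = j (t x) \<otimes>\<^bsub>N\<^esub> j (t y)"
      by (rule inj_onD[OF assms(3)]) (use j xy in auto)
  next
    show "j (t \<one>\<^bsub>M\<^esub>) = \<one>\<^bsub>N\<^esub>"
      using jk[of "\<one>\<^bsub>N\<^esub>"] by (simp add: monoid_homD[OF t] monoid_homD[OF assms(2)])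
  qed (use j in auto)
  then have hom: "restrict (\<lambda>x. j (t x)) (carrier M) \<in> monoid_hom M N"
    by (rule monoid_hom_restrict[OF M.monoid_axioms])
  show "\<exists>!t'. t' \<in> monoid_hom M N \<inter> extensional (carrier M) \<and> (\<forall>x\<in>carrier M. k (t' x) = t x)"
  proof (rule ex1I[of _ "restrict (\<lambda>x. j (t x)) (carrier M)"])
    show "restrict (\<lambda>x. j (t x)) (carrier M) \<in> monoid_hom M N \<inter> extensional (carrier M) \<and>
      (\<forall>x\<in>carrier M. k (restrict (\<lambda>x. j (t x)) (carrier M) x) = t x)"
      using hom j by simp
    fix t' assume t': "t' \<in> monoid_hom M N \<inter> extensional (carrier M) \<and> (\<forall>x\<in>carrier M. k (t' x) = t x)"
    show "t' = restrict (\<lambda>x. j (t x)) (carrier M)"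
    proof (rule extensionalityI[where A = "carrier M"])
      fix x assume x: "x \<in> carrier M"
      have "t' x \<in> carrier N" using t' x by (blast intro: monoid_homD(1))
      then show "t' x = restrict (\<lambda>x. j (t x)) (carrier M) x" using jk t' x by force
    qed (use t' in auto)
  qed
qed

lemma is_cokernel_inI:
  fixes N :: "('n, 'a) monoid_scheme" and G :: "('g, 'b) monoid_scheme" and H :: "('h, 'c) monoid_scheme"
  assumes mon: "monoid G" "monoid H" and k: "k \<in> monoid_hom N G" and e: "e \<in> monoid_hom G H"
    and ek: "\<And>n. n \<in> carrier N \<Longrightarrow> e (k n) = \<one>\<^bsub>H\<^esub>"
    and surj: "e ` carrier G = carrier H"
    and cong: "\<And>x y. \<lbrakk>x \<in> carrier G; y \<in> carrier G; e x = e y\<rbrakk> \<Longrightarrow> (x, y) \<in> generated_congruence N G k"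
  shows "is_cokernel_in TYPE('u) N G H k e"
  unfolding is_cokernel_in_def
proof (intro conjI allI impI ballI)
  interpret G: monoid G by fact
  show "e \<in> monoid_hom G H" by fact
  show "e (k n) = \<one>\<^bsub>H\<^esub>" if "n \<in> carrier N" for n by (rule ek[OF that])
  fix M :: "'u monoid" and q
  assume *: "monoid M \<and> q \<in> monoid_hom G M \<and> (\<forall>n\<in>carrier N. q (k n) = \<one>\<^bsub>M\<^esub>)"
  then interpret M: monoid M by blast
  have q: "q \<in> monoid_hom G M" and qk: "\<And>n. n \<in> carrier N \<Longrightarrow> q (k n) = \<one>\<^bsub>M\<^esub>" using * by auto
  define j where "j = inv_into (carrier G) e"
  have qj: "q (j (e g)) = q g" if "g \<in> carrier G" for g
  proof (rule generated_congruence_hom[OF mon(1) M.monoid_axioms q qk k cong])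
    show "j (e g) \<in> carrier G" "e (j (e g)) = e g"
      using that by (auto simp: j_def inv_into_into f_inv_into_f)
  qed (use that in auto)
  have "(\<lambda>h. q (j h)) \<in> monoid_hom H M"
  proof (rule monoid_homI)
    show "q (j h) \<in> carrier M" if "h \<in> carrier H" for h
      using that monoid_homD(1)[OF q] surj by (auto simp: j_def inv_into_into)
    fix h1 h2 assume "h1 \<in> carrier H" "h2 \<in> carrier H"
    then obtain g1 g2 where g: "g1 \<in> carrier G" "g2 \<in> carrier G" "h1 = e g1" "h2 = e g2"
      using surj by blast
    show "q (j (h1 \<otimes>\<^bsub>H\<^esub> h2)) = q (j h1) \<otimes>\<^bsub>M\<^esub> q (j h2)"
      using qj[of "g1 \<otimes>\<^bsub>G\<^esub> g2"] g by (simp add: monoid_homD[OF e] monoid_homD[OF q] qj)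
  next
    show "q (j \<one>\<^bsub>H\<^esub>) = \<one>\<^bsub>M\<^esub>" using qj[of "\<one>\<^bsub>G\<^esub>"] by (simp add: monoid_homD[OF e] monoid_homD[OF q])
  qed
  then have hom: "restrict (\<lambda>h. q (j h)) (carrier H) \<in> monoid_hom H M"
    by (rule monoid_hom_restrict[OF mon(2)])
  show "\<exists>!q'. q' \<in> monoid_hom H M \<inter> extensional (carrier H) \<and> (\<forall>g\<in>carrier G. q' (e g) = q g)"
  proof (rule ex1I[of _ "restrict (\<lambda>h. q (j h)) (carrier H)"])
    show "restrict (\<lambda>h. q (j h)) (carrier H) \<in> monoid_hom H M \<inter> extensional (carrier H) \<and>
      (\<forall>g\<in>carrier G. restrict (\<lambda>h. q (j h)) (carrier H) (e g) = q g)"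
      using hom qj surj by auto
    fix q' assume q': "q' \<in> monoid_hom H M \<inter> extensional (carrier H) \<and> (\<forall>g\<in>carrier G. q' (e g) = q g)"
    show "q' = restrict (\<lambda>h. q (j h)) (carrier H)"
    proof (rule extensionalityI[where A = "carrier H"])
      fix h assume h: "h \<in> carrier H"
      then obtain g where "g \<in> carrier G" "h = e g" using surj by blast
      then show "q' h = restrict (\<lambda>h. q (j h)) (carrier H) h" using h q' qj by simp
    qed (use q' in auto)
  qed
qed

theorem monoid_extension_universal:
  assumes "monoid_extension N G H k e"
  shows "is_kernel_in TYPE('u) N G H k e" and "is_cokernel_in TYPE('u) N G H k e"
proof -
  have *: "monoid N" "monoid G" "monoid H" "k \<in> monoid_hom N G" "e \<in> monoid_hom G H"
    "\<And>n. n \<in> carrier N \<Longrightarrow> e (k n) = \<one>\<^bsub>H\<^esub>"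
    using assms unfolding monoid_extension_def is_kernel_in_def by auto
  show "is_kernel_in TYPE('u) N G H k e"
    by (rule is_kernel_inI[OF *(1,4) monoid_extension_kernel[OF assms]])
  show "is_cokernel_in TYPE('u) N G H k e"
    by (rule is_cokernel_inI[OF *(2,3,4,5,6) monoid_extension_cokernel[OF assms]])
qed

end

theory Submission
  imports Defs
begin

text \<open>Every element of the fibre over \<open>h\<close> is \<open>k n s(h)\<close> for some \<open>n\<close>, unique up to \<open>\<sim>\<^sup>h\<close>, so \<open>f\<close> is a
  bijection, and the relations \<open>k(\<alpha> h n) s(h) = s(h) k(n)\<close> and \<open>k(\<chi> h\<^sub>1 h\<^sub>2) s(h\<^sub>1 h\<^sub>2) = s(h\<^sub>1) s(h\<^sub>2)\<close> make
  it multiplicative; the monoid laws and the universal properties are then transported from \<open>G\<close>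
  along \<open>f\<close>. Preservation of the unit means \<open>s(1) = 1\<close>, which is not assumed but follows from the
  existence of the associated factor system.\<close>

text \<open>The two sides of each monoid law have the same image in \<open>G\<close>, so injectivity
  of \<open>f\<close> gives the law in \<open>X\<close>. Since \<open>monoid_hom\<close> does not
  presuppose a monoid as its source, associativity of the crossed product can be pulled back from
  \<open>G\<close> instead of being computed from the factor system axioms.\<close>

lemma monoid_if_inj_hom:
  assumes G: "monoid G" and inj: "inj_on f (carrier X)"
    and closed: "\<And>x y. \<lbrakk>x \<in> carrier X; y \<in> carrier X\<rbrakk> \<Longrightarrow> x \<otimes>\<^bsub>X\<^esub> y \<in> carrier X"
    and one: "\<one>\<^bsub>X\<^esub> \<in> carrier X" and f: "f \<in> monoid_hom X G"
  shows "monoid X"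
proof -
  interpret G: monoid G by fact
  note [simp] = closed one monoid_homD[OF f]
  show ?thesis
    by (rule monoidI) (auto intro!: inj_onD[OF inj] simp: G.m_assoc)
qed

lemma monoid_iso_inv_into:
  assumes X: "monoid X" and f: "f \<in> monoid_iso X G"
  shows "inv_into (carrier X) f \<in> monoid_hom G X"
proof -
  interpret X: monoid X by fact
  have hom: "f \<in> monoid_hom X G" and bij: "bij_betw f (carrier X) (carrier G)"
    using f unfolding monoid_iso_def by auto
  let ?g = "inv_into (carrier X) f"
  have g: "?g y \<in> carrier X" "f (?g y) = y" if "y \<in> carrier G" for y
    using that bij_betw_imp_surj_on[OF bij] by (auto simp: inv_into_into f_inv_into_f)
  have gf: "?g (f x) = x" if "x \<in> carrier X" for x
    using that bij by (simp add: bij_betw_inv_into_left)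
  show ?thesis
  proof (rule monoid_homI)
    show "?g (x \<otimes>\<^bsub>G\<^esub> y) = ?g x \<otimes>\<^bsub>X\<^esub> ?g y" if "x \<in> carrier G" "y \<in> carrier G" for x y
      using gf[of "?g x \<otimes>\<^bsub>X\<^esub> ?g y"] that g by (simp add: monoid_homD[OF hom])
    show "?g \<one>\<^bsub>G\<^esub> = \<one>\<^bsub>X\<^esub>"
      using gf[of "\<one>\<^bsub>X\<^esub>"] by (simp add: monoid_homD[OF hom])
  qed (rule g)
qed

text \<open>The test type for an extension depends on the type of the middle monoid, so it changes
  from \<open>G\<close> to \<open>X\<close>; hence the free type \<open>'u\<close>. The kernel
  property is checked by the elementwise criterion \<open>is_kernel_inI\<close>, which works for
  every test type; the cokernel property of \<open>G\<close> is moved to \<open>'u\<close> by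
  \<open>monoid_extension_universal\<close>.\<close>

lemma monoid_extension_transport_universal:
  assumes ext: "monoid_extension N G H k e" and X: "monoid X" and f: "f \<in> monoid_iso X G"
    and k': "\<And>n. n \<in> carrier N \<Longrightarrow> k' n \<in> carrier X" "\<And>n. n \<in> carrier N \<Longrightarrow> f (k' n) = k n"
    and e': "\<And>x. x \<in> carrier X \<Longrightarrow> e' x = e (f x)"
  shows "k' \<in> monoid_hom N X" "e' \<in> monoid_hom X H"
    "is_kernel_in TYPE('u) N X H k' e'" "is_cokernel_in TYPE('u) N X H k' e'"
proof -
  have mon: "monoid N" "monoid G" "monoid H" and k: "k \<in> monoid_hom N G" and e: "e \<in> monoid_hom G H"
    using ext unfolding monoid_extension_def by auto
  interpret N: monoid N by (rule mon)
  interpret X: monoid X by fact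
  note ker = monoid_extension_kernel[OF ext]
  have fhom: "f \<in> monoid_hom X G" and bij: "bij_betw f (carrier X) (carrier G)"
    using f unfolding monoid_iso_def by auto
  have inj: "inj_on f (carrier X)" using bij by (rule bij_betw_imp_inj_on)
  define g where "g = inv_into (carrier X) f"
  have ghom: "g \<in> monoid_hom G X" unfolding g_def by (rule monoid_iso_inv_into[OF X f])
  have gf: "g (f x) = x" if "x \<in> carrier X" for x
    using that bij by (simp add: g_def bij_betw_inv_into_left)
  have fg: "f (g y) = y" if "y \<in> carrier G" for y
    using that bij by (simp add: g_def bij_betw_inv_into_right)
  \<comment> \<open>Equations between values of \<open>k'\<close> are checked after applying the
    injective \<open>f\<close>, where they become the homomorphism equations of
    \<open>k\<close>.\<close>
  show k'hom: "k' \<in> monoid_hom N X"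
  proof (rule monoid_homI)
    show "k' (m \<otimes>\<^bsub>N\<^esub> n) = k' m \<otimes>\<^bsub>X\<^esub> k' n" if "m \<in> carrier N" "n \<in> carrier N" for m n
      by (rule inj_onD[OF inj]) (use that in \<open>simp_all add: k' monoid_homD[OF fhom] monoid_homD[OF k]\<close>)
    show "k' \<one>\<^bsub>N\<^esub> = \<one>\<^bsub>X\<^esub>"
      by (rule inj_onD[OF inj]) (simp_all add: k' monoid_homD[OF fhom] monoid_homD[OF k])
  qed (rule k'(1))
  show e'hom: "e' \<in> monoid_hom X H"
    by (rule monoid_homI) (simp_all add: e' monoid_homD[OF fhom] monoid_homD[OF e])
  have ek: "e (k n) = \<one>\<^bsub>H\<^esub>" if "n \<in> carrier N" for n
    using ker(2) that by blast
  have "inj_on k' (carrier N)"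
  proof (rule inj_onI)
    fix m n assume "m \<in> carrier N" "n \<in> carrier N" "k' m = k' n"
    then show "m = n" using k'(2) inj_onD[OF ker(1)] by metis
  qed
  moreover have "k' ` carrier N = {x \<in> carrier X. e' x = \<one>\<^bsub>H\<^esub>}"
  proof (intro subset_antisym subsetI)
    fix x assume "x \<in> k' ` carrier N"
    then show "x \<in> {x \<in> carrier X. e' x = \<one>\<^bsub>H\<^esub>}" using k' e' ek by auto
  next
    \<comment> \<open>If \<open>e' x = 1\<close>, then \<open>f x\<close> lies in the fibre of
      \<open>e\<close> over 1, hence equals some \<open>k n = f (k' n)\<close>, and \<open>f\<close>
      can be cancelled.\<close>
    fix x assume "x \<in> {x \<in> carrier X. e' x = \<one>\<^bsub>H\<^esub>}"
    then have x: "x \<in> carrier X" and "f x \<in> k ` carrier N"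
      unfolding ker(2) using e' monoid_homD(1)[OF fhom] by auto
    then obtain n where n: "n \<in> carrier N" "f x = f (k' n)" using k'(2) by auto
    then have "x = k' n" using inj_onD[OF inj] x k'(1) by blast
    then show "x \<in> k' ` carrier N" using n(1) by blast
  qed
  ultimately have "is_kernel_in TYPE('u) N X H k' e'"
    by (rule is_kernel_inI[OF mon(1) k'hom])
  moreover have "is_cokernel_in TYPE('u) N X H k' e'"
    unfolding is_cokernel_in_def
  proof (intro conjI ballI allI impI)
    show "e' (k' n) = \<one>\<^bsub>H\<^esub>" if "n \<in> carrier N" for n
      using that k' e' ek by simp
    fix M :: "'u monoid" and q
    assume *: "monoid M \<and> q \<in> monoid_hom X M \<and> (\<forall>n\<in>carrier N. q (k' n) = \<one>\<^bsub>M\<^esub>)"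
    \<comment> \<open>A test map \<open>q\<close> on \<open>X\<close> that is trivial on the image
      of \<open>k'\<close> becomes, after composition with the inverse \<open>g\<close> of
      \<open>f\<close>, a test map on \<open>G\<close> that is trivial on the image of
      \<open>k\<close>.\<close>
    have "g (k n) = k' n" if "n \<in> carrier N" for n
      using gf[OF k'(1)[OF that]] k'(2)[OF that] by simp
    with * have "monoid M \<and> (\<lambda>y. q (g y)) \<in> monoid_hom G M \<and> (\<forall>n\<in>carrier N. q (g (k n)) = \<one>\<^bsub>M\<^esub>)"
      using monoid_hom_comp[OF ghom] by auto
    then have "\<exists>!q'. q' \<in> monoid_hom H M \<inter> extensional (carrier H) \<and>
        (\<forall>y\<in>carrier G. q' (e y) = q (g y))"
      using monoid_extension_universal(2)[OF ext, where 'u = 'u] unfolding is_cokernel_in_def by blast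
    \<comment> \<open>Substituting \<open>y = f x\<close>, which reaches all of \<open>G\<close>,
      shows that \<open>q\<close> and its composite with \<open>g\<close> have the same
      factorisations through \<open>H\<close>, so unique existence carries over.\<close>
    moreover have "(\<forall>y\<in>carrier G. q' (e y) = q (g y)) \<longleftrightarrow> (\<forall>x\<in>carrier X. q' (e' x) = q x)" for q'
      unfolding bij_betw_imp_surj_on[OF bij, symmetric] by (simp add: e' gf)
    ultimately show "\<exists>!q'. q' \<in> monoid_hom H M \<inter> extensional (carrier H) \<and>
        (\<forall>x\<in>carrier X. q' (e' x) = q x)"
      by simp
  qed (rule e'hom)
  ultimately show "is_kernel_in TYPE('u) N X H k' e'" "is_cokernel_in TYPE('u) N X H k' e'" .
qed

lemma monoid_extension_transport:
  assumes "monoid_extension N G H k e" "monoid X" "f \<in> monoid_iso X G"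
    and "\<And>n. n \<in> carrier N \<Longrightarrow> k' n \<in> carrier X" "\<And>n. n \<in> carrier N \<Longrightarrow> f (k' n) = k n"
    and "\<And>x. x \<in> carrier X \<Longrightarrow> e' x = e (f x)"
  shows "monoid_extension N X H k' e'"
  using assms(1,2) monoid_extension_transport_universal[OF assms]
  unfolding monoid_extension_def by simp

text \<open>With \<open>u = s(1)\<close>, the cocycle relation \<open>k(\<chi>(1, 1)) u = u u\<close> and \<open>\<chi>(1, 1) = 1\<close> give \<open>u u = u\<close>;
  writing \<open>1 = k n u\<close> then yields \<open>u = k n u u = k n u = 1\<close>.\<close>

lemma associated_factor_system_splitting_one:
  assumes ext: "monoid_extension N G H k e" and gen: "weak_generator N G k e \<one>\<^bsub>H\<^esub> (s \<one>\<^bsub>H\<^esub>)"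
    and assoc: "associated_factor_system N G H k s E \<alpha> \<chi>"
  shows "s \<one>\<^bsub>H\<^esub> = \<one>\<^bsub>G\<^esub>"
proof -
  have k: "k \<in> monoid_hom N G" and e: "e \<in> monoid_hom G H" and G: "monoid G"
    using ext unfolding monoid_extension_def by auto
  interpret G: monoid G by (rule G)
  interpret factor_system N H E \<alpha> \<chi>
    using assoc unfolding associated_factor_system_def by blast
  let ?u = "s \<one>\<^bsub>H\<^esub>"
  have u: "?u \<in> carrier G" using gen unfolding weak_generator_def by blast
  have "\<chi> \<one>\<^bsub>H\<^esub> \<one>\<^bsub>H\<^esub> = \<one>\<^bsub>N\<^esub>" by (rule rel_one[OF cocycle_unit_left]) simp
  moreover have "k (\<chi> \<one>\<^bsub>H\<^esub> \<one>\<^bsub>H\<^esub>) \<otimes>\<^bsub>G\<^esub> s (\<one>\<^bsub>H\<^esub> \<otimes>\<^bsub>H\<^esub> \<one>\<^bsub>H\<^esub>) = ?u \<otimes>\<^bsub>G\<^esub> ?u"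
    using assoc unfolding associated_factor_system_def by blast
  ultimately have uu: "?u \<otimes>\<^bsub>G\<^esub> ?u = ?u" using u by (simp add: monoid_homD[OF k])
  \<comment> \<open>The unit of \<open>G\<close> lies in the fibre over 1, which \<open>s\<close> at
    1 generates.\<close>
  obtain n where n: "n \<in> carrier N" "\<one>\<^bsub>G\<^esub> = k n \<otimes>\<^bsub>G\<^esub> ?u"
    using gen monoid_homD(3)[OF e] unfolding weak_generator_def by (metis G.one_closed)
  have "?u = (k n \<otimes>\<^bsub>G\<^esub> ?u) \<otimes>\<^bsub>G\<^esub> ?u" using n(2)[symmetric] u by simp
  also have "\<dots> = k n \<otimes>\<^bsub>G\<^esub> ?u"
    using G.m_assoc[OF monoid_homD(1)[OF k n(1)] u u] uu by simp
  finally show ?thesis using n(2) by simp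
qed

theorem mainTheorem1:
  fixes N :: "('n, 'a) monoid_scheme" and G :: "('g, 'b) monoid_scheme" and H :: "('h, 'c) monoid_scheme"
    and k :: "'n \<Rightarrow> 'g" and e :: "'g \<Rightarrow> 'h" and s :: "'h \<Rightarrow> 'g"
    and E :: "'h \<Rightarrow> ('n \<times> 'n) set" and \<alpha> :: "'h \<Rightarrow> 'n \<Rightarrow> 'n" and \<chi> :: "'h \<Rightarrow> 'h \<Rightarrow> 'n"
  assumes "weakly_Schreier N G H k e"
    and "set_splitting G H e s"
    and "\<forall>h\<in>carrier H. weak_generator N G k e h (s h)"
    and "associated_factor_system N G H k s E \<alpha> \<chi>"
  shows "let X = crossed_product N H E \<alpha> \<chi>;
             f = crossed_product_map G k s;
             k' = crossed_product_incl H E;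
             e' = crossed_product_proj
         in (\<forall>h\<in>carrier H. \<forall>n\<in>carrier N. f (E h `` {n}, h) = k n \<otimes>\<^bsub>G\<^esub> s h) \<and>
            monoid X \<and> f \<in> monoid_iso X G \<and>
            monoid_extension N X H k' e' \<and>
            (\<forall>n\<in>carrier N. f (k' n) = k n) \<and>
            (\<forall>x\<in>carrier X. e (f x) = e' x)"
proof -
  let ?X = "crossed_product N H E \<alpha> \<chi>" and ?f = "crossed_product_map G k s"
  have ext: "monoid_extension N G H k e"
    using assms(1) unfolding weakly_Schreier_def by blast
  then have mon: "monoid N" "monoid G" "monoid H"
    and k: "k \<in> monoid_hom N G" and e: "e \<in> monoid_hom G H"
    unfolding monoid_extension_def by auto
  interpret G: monoid G by (rule mon)
  interpret factor_system N H E \<alpha> \<chi>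
    using assms(4) unfolding associated_factor_system_def by blast
  have rel: "(m, n) \<in> E h \<longleftrightarrow> k m \<otimes>\<^bsub>G\<^esub> s h = k n \<otimes>\<^bsub>G\<^esub> s h"
    if "h \<in> carrier H" "m \<in> carrier N" "n \<in> carrier N" for h m n
    using assms(4) that unfolding associated_factor_system_def by blast
  have act: "k (\<alpha> h n) \<otimes>\<^bsub>G\<^esub> s h = s h \<otimes>\<^bsub>G\<^esub> k n" if "h \<in> carrier H" "n \<in> carrier N" for h n
    using assms(4) that unfolding associated_factor_system_def by blast
  have cocycle: "k (\<chi> h h') \<otimes>\<^bsub>G\<^esub> s (h \<otimes>\<^bsub>H\<^esub> h') = s h \<otimes>\<^bsub>G\<^esub> s h'"
    if "h \<in> carrier H" "h' \<in> carrier H" for h h'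
    using assms(4) that unfolding associated_factor_system_def by blast
  have s: "s h \<in> carrier G" "e (s h) = h" if "h \<in> carrier H" for h
    using assms(2) that unfolding set_splitting_def by auto
  \<comment> \<open>This serves both unit conditions below: \<open>f\<close> preserves the unit, and
    \<open>f ([n], 1) = k n\<close>.\<close>
  have s_one: "s \<one>\<^bsub>H\<^esub> = \<one>\<^bsub>G\<^esub>"
    using associated_factor_system_splitting_one[OF ext _ assms(4)] assms(3) by simp
  have ek: "e (k n) = \<one>\<^bsub>H\<^esub>" if "n \<in> carrier N" for n
    using monoid_extension_kernel(2)[OF ext] that by blast

  \<comment> \<open>The \<open>the_elem\<close> in \<open>crossed_product_map\<close> has the
    intended value only on a singleton: \<open>rel\<close> makes the map constant on the class, and
    reflexivity makes the class nonempty.\<close>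
  have f: "?f (E h `` {n}, h) = k n \<otimes>\<^bsub>G\<^esub> s h" if "h \<in> carrier H" "n \<in> carrier N" for h n
  proof -
    have "m \<in> carrier N" if "(n, m) \<in> E h" for m
      using equiv[OF \<open>h \<in> carrier H\<close>] that unfolding equiv_def by blast
    then have "k m \<otimes>\<^bsub>G\<^esub> s h = k n \<otimes>\<^bsub>G\<^esub> s h" if "m \<in> E h `` {n}" for m
      using rel[of h n m] \<open>h \<in> carrier H\<close> \<open>n \<in> carrier N\<close> that by simp
    moreover have "n \<in> E h `` {n}"
      using equiv_class_self[OF equiv[OF that(1)] that(2)] .
    ultimately have "(\<lambda>m. k m \<otimes>\<^bsub>G\<^esub> s h) ` (E h `` {n}) = {k n \<otimes>\<^bsub>G\<^esub> s h}"
      by blast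
    then show ?thesis by (simp add: crossed_product_map_def)
  qed
  have cls: "(E h `` {n}, h) \<in> carrier ?X" if "h \<in> carrier H" "n \<in> carrier N" for h n
    using that by (simp add: crossed_product_def quotientI)
  have clsE: "\<exists>h\<in>carrier H. \<exists>n\<in>carrier N. x = (E h `` {n}, h)" if "x \<in> carrier ?X" for x
    using that by (auto simp: crossed_product_def elim!: quotientE)
  have one: "\<one>\<^bsub>?X\<^esub> = (E \<one>\<^bsub>H\<^esub> `` {\<one>\<^bsub>N\<^esub>}, \<one>\<^bsub>H\<^esub>)"
    by (simp add: crossed_product_def)
  have closed: "x \<otimes>\<^bsub>?X\<^esub> y \<in> carrier ?X" if "x \<in> carrier ?X" "y \<in> carrier ?X" for x y
    using clsE[OF that(1)] clsE[OF that(2)]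
    by (auto simp: crossed_product_mult act_closed cocycle_closed intro!: cls)
  \<comment> \<open>The component \<open>h\<close> can be read off from the value of
    \<open>f\<close>; this gives half of injectivity and also \<open>e f = e'\<close>.\<close>
  have eval: "e (k n \<otimes>\<^bsub>G\<^esub> s h) = h" if "h \<in> carrier H" "n \<in> carrier N" for h n
    using that s by (simp add: monoid_homD[OF k] monoid_homD[OF e] ek)

  have f_mult: "?f (x \<otimes>\<^bsub>?X\<^esub> y) = ?f x \<otimes>\<^bsub>G\<^esub> ?f y" if xy: "x \<in> carrier ?X" "y \<in> carrier ?X" for x y
  proof -
    obtain h m where x: "x = (E h `` {m}, h)" "h \<in> carrier H" "m \<in> carrier N"
      using clsE[OF xy(1)] by blast
    obtain h' n where y: "y = (E h' `` {n}, h')" "h' \<in> carrier H" "n \<in> carrier N"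
      using clsE[OF xy(2)] by blast
    note carr = x(2,3) y(2,3) s(1) act_closed cocycle_closed monoid_homD(1)[OF k]
    have "?f (x \<otimes>\<^bsub>?X\<^esub> y) = k (m \<otimes>\<^bsub>N\<^esub> \<alpha> h n \<otimes>\<^bsub>N\<^esub> \<chi> h h') \<otimes>\<^bsub>G\<^esub> s (h \<otimes>\<^bsub>H\<^esub> h')"
      by (simp add: x(1) y(1) crossed_product_mult f carr)
    \<comment> \<open>The bracketing isolates the factor that \<open>cocycle\<close> rewrites to
      \<open>s h\<close> times \<open>s h'\<close>; regrouping then exposes the left side of
      \<open>act\<close>, which moves \<open>k n\<close> to the right of \<open>s h\<close>.\<close>
    also have "\<dots> = k m \<otimes>\<^bsub>G\<^esub> k (\<alpha> h n) \<otimes>\<^bsub>G\<^esub> (k (\<chi> h h') \<otimes>\<^bsub>G\<^esub> s (h \<otimes>\<^bsub>H\<^esub> h'))"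
      by (simp add: carr monoid_homD(2)[OF k] G.m_assoc)
    also have "\<dots> = k m \<otimes>\<^bsub>G\<^esub> (k (\<alpha> h n) \<otimes>\<^bsub>G\<^esub> s h) \<otimes>\<^bsub>G\<^esub> s h'"
      by (simp add: cocycle carr G.m_assoc)
    also have "\<dots> = ?f x \<otimes>\<^bsub>G\<^esub> ?f y"
      by (simp add: act x(1) y(1) f carr G.m_assoc)
    finally show ?thesis .
  qed
  have f_hom: "?f \<in> monoid_hom ?X G"
  proof (rule monoid_homI)
    show "?f x \<in> carrier G" if "x \<in> carrier ?X" for x
      using clsE[OF that] s(1) monoid_homD(1)[OF k] by (auto simp: f)
    show "?f \<one>\<^bsub>?X\<^esub> = \<one>\<^bsub>G\<^esub>"
      by (simp add: one f s_one monoid_homD[OF k])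
  qed (rule f_mult)
  have inj: "inj_on ?f (carrier ?X)"
  proof (rule inj_onI)
    fix x y assume "x \<in> carrier ?X" "y \<in> carrier ?X" and eq: "?f x = ?f y"
    then obtain h m h' n where x: "x = (E h `` {m}, h)" "h \<in> carrier H" "m \<in> carrier N"
      and y: "y = (E h' `` {n}, h')" "h' \<in> carrier H" "n \<in> carrier N"
      using clsE by meson
    \<comment> \<open>Applying \<open>e\<close> gives \<open>h = h'\<close>; only then do both
      products lie over one index, and \<open>rel\<close> turns their equality into equality of
      classes.\<close>
    have eq': "k m \<otimes>\<^bsub>G\<^esub> s h = k n \<otimes>\<^bsub>G\<^esub> s h'" using eq x y f by simp
    then have "h = h'" using eval x y by metis
    moreover from this have "(m, n) \<in> E h" using rel eq' x y by simp
    ultimately show "x = y" using x y equiv_class_eq[OF equiv] by simp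
  qed
  have surj: "carrier G \<subseteq> ?f ` carrier ?X"
  proof
    fix g assume g: "g \<in> carrier G"
    then have h: "e g \<in> carrier H" by (rule monoid_homD(1)[OF e])
    then obtain n where n: "n \<in> carrier N" "g = k n \<otimes>\<^bsub>G\<^esub> s (e g)"
      using assms(3) g unfolding weak_generator_def by blast
    then have "g = ?f (E (e g) `` {n}, e g)" using f[OF h n(1)] by simp
    then show "g \<in> ?f ` carrier ?X" using cls[OF h n(1)] by blast
  qed
  have X: "monoid ?X"
    by (rule monoid_if_inj_hom[OF mon(2) inj closed _ f_hom]) (auto simp: one intro: cls)
  have iso: "?f \<in> monoid_iso ?X G"
    using f_hom inj surj monoid_homD(1)[OF f_hom] by (auto simp: monoid_iso_def bij_betw_def)
  have incl: "crossed_product_incl H E n \<in> carrier ?X" "?f (crossed_product_incl H E n) = k n"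
    if "n \<in> carrier N" for n
    using that by (simp_all add: crossed_product_incl_def cls f s_one monoid_homD[OF k])
  have proj: "crossed_product_proj x = e (?f x)" if "x \<in> carrier ?X" for x
    using clsE[OF that] by (auto simp: crossed_product_proj_def f eval)
  have "monoid_extension N ?X H (crossed_product_incl H E) crossed_product_proj"
    by (rule monoid_extension_transport[OF ext X iso incl proj])
  then show ?thesis
    unfolding Let_def using f X iso incl(2) proj by simp
qed

end
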